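(* Let $K$ be an arbitrary field, $m\geq 4$, $\Gamma\in\mathbb{S}(m)$, and let $A\in\mathcal{A}(m,\Gamma)$. Suppose that $\operatorname{ind}(\Gamma)=\{\nu_1\}$. Then the commutative algebra $A$ is generated by the elements $\{f_{\nu_1},x^{m+i}\mid i=0,1,\ldots,m-1\}$ subject to the defining relations $$f_{\nu_1}^{\lfloor\frac{m-1}{\nu_1}\rfloor+1}=\Big[f_{\nu_1}^{\lfloor\frac{m-1}{\nu_1}\rfloor+1}\Big],$$ $$x^{m+i}x^{m+j}=[x^{2m+i+j}]\quad\text{for } i,j=0,1,\ldots,m-1,$$ $$x^{m+i}f_{\nu_1}=[x^{m+i}f_{\nu_1}]\quad\text{for } i=0,1,\ldots,m-1.$$
   Context: $\mathbb{S}(m)$ is the set consisting of the empty set and of all non-empty subsets $\Gamma\subseteq\{2,\ldots,m-2\}$ such that $\Gamma+\Gamma\subseteq\Gamma\cup[m,\infty)$. An element of $\Gamma$ is decomposable if it is a sum of two elements of $\Gamma$; $\operatorname{ind}(\Gamma)$ is the set of indecomposable (i.e. not decomposable) elements of $\Gamma$. $\mathcal{A}(m)$ is the set of all $K$-subalgebras $A$ of $K[x]$ such that $x^mK[x]\subset A$ and $x^{m-1}\notin A$. For $A\in\mathcal{A}(m)$, $\Gamma_A$ is the set of integers $\gamma$ with $1\leq\gamma\leq m-1$ such that $A$ contains an element of the form $x^\gamma+\sum_{j>\gamma}\lambda_jx^j$ with $\lambda_j\in K$; one has $\Gamma_A\in\mathbb{S}(m)$. $\mathcal{A}(m,\Gamma):=\{A\in\mathcal{A}(m)\mid\Gamma_A=\Gamma\}$.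 The algebra $\overline{A}:=A/x^mK[x]\subseteq F:=K[x]/x^mK[x]$ has a unique $K$-basis $\{1,f_\gamma\mid\gamma\in\Gamma\}$ (the canonical basis) with $f_\gamma=x^\gamma+\sum_{\delta\in C\Gamma(\gamma)}\lambda_{\gamma\delta}x^\delta$, $\lambda_{\gamma\delta}\in K$, where $C\Gamma(\gamma)=\{\delta\mid\delta\notin\Gamma,\gamma<\delta\leq m-1\}$. Identifying $F$ with the space of polynomials of degree $\leq m-1$, each $f_\gamma$ is regarded as a polynomial of degree $\leq m-1$ lying in $A$. Bracket notation: every $p\in K[x]$ is a unique sum $p=\overline{p}+[p]$ with $\deg\overline{p}\leq m-1$ and $[p]\in x^mK[x]$. Since $x^mK[x]=\bigoplus_{i=0}^{m-1}K[x^m]x^{m+i}$, one has a unique expression $[p]=\sum_{i=0}^{m-1}p_i(x^m)x^{m+i}$ with $p_i(x^m)\in K[x^m]$. In a relation, the symbol $[p]$ stands for this expression as a polynomial in the generators $x^m,x^{m+1},\ldots,x^{2m-1}$, where $p$ is computed in $K[x]$. All other products in the relations are monomials in the abstract generators. *)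

theory Defs
  imports
    "HOL-Library.Poly_Mapping"
    "HOL-Computational_Algebra.Polynomial"
begin

section \<open>Polynomial rings in several variables, and presentations\<close>

text \<open>
  A monomial in variables from the type \<open>'v\<close> is a finitely supported exponent function
  \<open>'v \<Rightarrow>\<^sub>0 nat\<close>. The ring structure is the convolution product provided by the theory
  \<open>Poly_Mapping\<close>, so \<open>('v, 'k) mpoly\<close> is the commutative polynomial ring over \<open>'k\<close>
  in the variables \<open>'v\<close>.
\<close>

type_synonym ('v, 'k) mpoly = "('v \<Rightarrow>\<^sub>0 nat) \<Rightarrow>\<^sub>0 'k"

definition Const :: "'k::zero \<Rightarrow> ('v, 'k) mpoly" where
  "Const c = Poly_Mapping.single 0 c"

definition Var :: "'v \<Rightarrow> ('v, 'k::zero_neq_one) mpoly" where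
  "Var v = Poly_Mapping.single (Poly_Mapping.single v 1) 1"

definition mpolys_in :: "'v set \<Rightarrow> ('v, 'k::zero) mpoly set" where
  "mpolys_in V = {P. \<forall>t\<in>Poly_Mapping.keys P. Poly_Mapping.keys t \<subseteq> V}"

text \<open>The \<open>'k\<close>-algebra homomorphism to \<open>'k[x]\<close> sending each variable \<open>v\<close> to \<open>a v\<close>.\<close>

definition meval :: "('v \<Rightarrow> 'k::field poly) \<Rightarrow> ('v, 'k) mpoly \<Rightarrow> 'k poly" where
  "meval a P =
     (\<Sum>t\<in>Poly_Mapping.keys P. smult (Poly_Mapping.lookup P t)
       (\<Prod>v\<in>Poly_Mapping.keys t. a v ^ Poly_Mapping.lookup t v))"

text \<open>The ideal generated by \<open>R\<close> inside the polynomial ring in the variables \<open>V\<close> only.\<close>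

definition mideal_in :: "'v set \<Rightarrow> ('v, 'k::field) mpoly set \<Rightarrow> ('v, 'k) mpoly set" where
  "mideal_in V R =
     {(\<Sum>r\<in>S. q r * r) | S q. finite S \<and> S \<subseteq> R \<and> (\<forall>r\<in>S. q r \<in> mpolys_in V)}"

text \<open>
  The algebra \<open>A\<close> is generated by the elements \<open>a v\<close>, \<open>v \<in> V\<close>, subject to the defining
  relations \<open>l = r\<close>, \<open>(l, r) \<in> R\<close>.
\<close>

definition presented_by ::
  "'k::field poly set \<Rightarrow> 'v set \<Rightarrow> ('v \<Rightarrow> 'k poly)
     \<Rightarrow> (('v, 'k) mpoly \<times> ('v, 'k) mpoly) set \<Rightarrow> bool" where
  "presented_by A V a R \<longleftrightarrow>
     fst ` R \<subseteq> mpolys_in V \<and> snd ` R \<subseteq> mpolys_in V \<and>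
     meval a ` mpolys_in V = A \<and>
     {P \<in> mpolys_in V. meval a P = 0} = mideal_in V {l - r | l r. (l, r) \<in> R}"


section \<open>Semigroup data\<close>

definition SS :: "nat \<Rightarrow> nat set set" where
  "SS m = {{}} \<union> {\<Gamma>. \<Gamma> \<noteq> {} \<and> \<Gamma> \<subseteq> {2..m - 2} \<and> (\<forall>a\<in>\<Gamma>. \<forall>b\<in>\<Gamma>. a + b \<in> \<Gamma> \<union> {m..})}"

definition decomposable :: "nat set \<Rightarrow> nat \<Rightarrow> bool" where
  "decomposable \<Gamma> \<gamma> \<longleftrightarrow> (\<exists>a\<in>\<Gamma>. \<exists>b\<in>\<Gamma>. \<gamma> = a + b)"

definition ind :: "nat set \<Rightarrow> nat set" where
  "ind \<Gamma> = {\<gamma> \<in> \<Gamma>. \<not> decomposable \<Gamma> \<gamma>}"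


section \<open>The algebras\<close>

definition is_subalgebra :: "'k::field poly set \<Rightarrow> bool" where
  "is_subalgebra A \<longleftrightarrow> module.subspace smult A \<and> 1 \<in> A \<and> (\<forall>p\<in>A. \<forall>q\<in>A. p * q \<in> A)"

definition AA :: "nat \<Rightarrow> 'k::field poly set set" where
  "AA m = {A. is_subalgebra A \<and> range (\<lambda>q. monom 1 m * q) \<subseteq> A \<and> monom 1 (m - 1) \<notin> A}"

definition Gam :: "nat \<Rightarrow> 'k::field poly set \<Rightarrow> nat set" where
  "Gam m A = {\<gamma> \<in> {1..m - 1}. \<exists>p\<in>A. coeff p \<gamma> = 1 \<and> (\<forall>j<\<gamma>. coeff p j = 0)}"

definition AAG :: "nat \<Rightarrow> nat set \<Rightarrow> 'k::field poly set set" where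
  "AAG m \<Gamma> = {A \<in> AA m. Gam m A = \<Gamma>}"

definition CGam :: "nat \<Rightarrow> nat set \<Rightarrow> nat \<Rightarrow> nat set" where
  "CGam m \<Gamma> \<gamma> = {\<delta>. \<delta> \<notin> \<Gamma> \<and> \<gamma> < \<delta> \<and> \<delta> \<le> m - 1}"

text \<open>
  \<open>K[x]/x\<^sup>mK[x]\<close> is identified with the polynomials of degree at most \<open>m - 1\<close>; the residue
  map is then \<open>poly_cutoff m\<close>, and the algebra \<open>A/x\<^sup>mK[x]\<close> is the image of \<open>A\<close> under it.
\<close>

definition Abar :: "nat \<Rightarrow> 'k::field poly set \<Rightarrow> 'k poly set" where
  "Abar m A = poly_cutoff m ` A"

definition is_canonical_basis :: "nat \<Rightarrow> 'k::field poly set \<Rightarrow> (nat \<Rightarrow> 'k poly) \<Rightarrow> bool" where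
  "is_canonical_basis m A f \<longleftrightarrow>
     (\<forall>\<gamma>\<in>Gam m A. \<exists>c. f \<gamma> = monom 1 \<gamma> + (\<Sum>\<delta>\<in>CGam m (Gam m A) \<gamma>. monom (c \<delta>) \<delta>)) \<and>
     \<not> module.dependent smult (insert 1 (f ` Gam m A)) \<and>
     module.span smult (insert 1 (f ` Gam m A)) = Abar m A"

text \<open>
  Only the values of \<open>f\<close> on \<open>Gam m A\<close> are constrained by \<open>is_canonical_basis\<close>, hence the
  description is applied to each element of the basis and not to the function \<open>f\<close>. It is
  meaningful for \<open>A \<in> AA m\<close> and \<open>\<gamma> \<in> Gam m A\<close>.
\<close>

definition canon :: "nat \<Rightarrow> 'k::field poly set \<Rightarrow> nat \<Rightarrow> 'k poly" where
  "canon m A \<gamma> = (THE p. \<exists>f. is_canonical_basis m A f \<and> p = f \<gamma>)"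


section \<open>Generators and bracket notation\<close>

text \<open>
  \<open>GF\<close> is the abstract generator standing for \<open>f\<^bsub>\<nu>\<^esub>\<close>, and \<open>GX i\<close> the one standing for
  \<open>x\<^bsup>m + i\<^esup>\<close>.
\<close>

datatype gen = GF | GX nat

definition gens :: "nat \<Rightarrow> gen set" where
  "gens m = insert GF (GX ` {..<m})"

fun gen_val :: "nat \<Rightarrow> 'k::field poly \<Rightarrow> gen \<Rightarrow> 'k poly" where
  "gen_val m f GF = f"
| "gen_val m f (GX i) = monom 1 (m + i)"

text \<open>
  The expression \<open>\<Sum>i<m. p\<^sub>i(x\<^sup>m) x\<^bsup>m + i\<^esup>\<close> of \<open>[p]\<close>, written in the abstract generators.
  The coefficient of \<open>t\<^sup>k\<close> in \<open>p\<^sub>i(t)\<close> is that of \<open>x\<^bsup>m + i + m k\<^esup>\<close> in \<open>p\<close> (for \<open>k > degree p\<close> it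
  is zero), and \<open>x\<^sup>m\<close> is the generator \<open>GX 0\<close>; see \<open>bracket_decomposition\<close>.
\<close>

definition bracket :: "nat \<Rightarrow> 'k::field poly \<Rightarrow> (gen, 'k) mpoly" where
  "bracket m p =
     (\<Sum>i<m. (\<Sum>k\<le>degree p. Const (coeff p (m + i + m * k)) * Var (GX 0) ^ k) * Var (GX i))"

lemma bracket_decomposition:
  fixes p :: "'k::field poly"
  assumes "m > 0"
  shows "p = poly_cutoff m p +
    (\<Sum>i<m. (\<Sum>k\<le>degree p. [:coeff p (m + i + m * k):] * monom 1 m ^ k) * monom 1 (m + i))"
proof -
  let ?g = "\<lambda>n. monom (coeff p (m + n)) (m + n)"
  have "(\<Sum>i<m. (\<Sum>k\<le>degree p. [:coeff p (m + i + m * k):] * monom 1 m ^ k) * monom 1 (m + i))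
      = (\<Sum>i<m. \<Sum>k\<le>degree p. ?g (i + m * k))"
    unfolding sum_distrib_right
    by (simp add: monom_power mult_monom smult_monom ac_simps)
  also have "\<dots> = (\<Sum>k<Suc (degree p). \<Sum>i<m. ?g (i + m * k))"
    by (subst sum.swap) (simp add: lessThan_Suc_atMost)
  also have "\<dots> = (\<Sum>k<Suc (degree p). sum ?g {k * m..<k * m + m})"
  proof (rule sum.cong[OF refl])
    fix k
    show "(\<Sum>i<m. ?g (i + m * k)) = sum ?g {k * m..<k * m + m}"
      by (rule sum.reindex_bij_witness[of _ "\<lambda>n. n - m * k" "\<lambda>i. i + m * k"])
        (auto simp: mult.commute)
  qed
  also have "\<dots> = sum ?g {..<Suc (degree p) * m}"
    by (rule sum.nat_group)
  finally have eq: "(\<Sum>i<m. (\<Sum>k\<le>degree p. [:coeff p (m + i + m * k):] * monom 1 m ^ k)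
      * monom 1 (m + i)) = sum ?g {..<Suc (degree p) * m}" .
  have "coeff (sum ?g {..<Suc (degree p) * m}) n = (if n < m then 0 else coeff p n)" for n
  proof (cases "n < m")
    case True
    then show ?thesis by (simp add: coeff_sum)
  next
    case False
    have "coeff (sum ?g {..<Suc (degree p) * m}) n
        = (\<Sum>j<Suc (degree p) * m. if j = n - m then coeff p n else 0)"
      unfolding coeff_sum using False by (intro sum.cong) auto
    also have "\<dots> = (if n - m < Suc (degree p) * m then coeff p n else 0)"
      by simp
    also have "\<dots> = coeff p n"
    proof (cases "n \<le> degree p")
      case True
      have "Suc (degree p) * 1 \<le> Suc (degree p) * m"
        using assms by (intro mult_le_mono) auto
      then show ?thesis using True by auto
    qed (simp add: coeff_eq_0)
    finally show ?thesis using False by simp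
  qed
  then show ?thesis
    unfolding eq by (simp add: poly_eq_iff coeff_poly_cutoff)
qed

end

theory Submission
  imports Defs
begin

text \<open>
  Since \<open>\<nu>\<close> is the only indecomposable element, \<open>\<Gamma>\<close> consists of the positive multiples of \<open>\<nu>\<close> below \<open>m\<close>.
  Put \<open>K = (m - 1) div \<nu> + 1\<close>. The powers \<open>f\<^sup>a\<close> with \<open>a < K\<close> have the orders \<open>a \<nu>\<close>, which exhaust the
  orders below \<open>m\<close> of elements of \<open>A\<close>; so \<open>A\<close> is the direct sum of the span of these powers and
  \<open>x\<^sup>mK[x]\<close>. Conversely, the relations rewrite every monomial in the generators either to a power
  \<open>f\<^sup>a\<close> with \<open>a < K\<close> or to a bracket: a product of a generator \<open>x\<^bsup>m + i\<^esup>\<close> or \<open>f\<close> with a bracket is again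
  congruent to a bracket. Hence a relation among the generators reduces to a normal form with
  value \<open>0\<close>, and by the direct sum decomposition this normal form is \<open>0\<close>.
\<close>

subsection \<open>Multivariate polynomials\<close>

lemma mpolys_in_add: "P \<in> mpolys_in V \<Longrightarrow> Q \<in> mpolys_in V \<Longrightarrow> P + Q \<in> mpolys_in V"
  for P Q :: "('v, 'k::comm_monoid_add) mpoly"
  using Poly_Mapping.keys_add[of P Q] by (force simp: mpolys_in_def)

lemma mpolys_in_Const: "Const c \<in> mpolys_in V"
  by (simp add: mpolys_in_def Const_def)

lemma mpolys_in_0: "0 \<in> mpolys_in V"
  by (simp add: mpolys_in_def)

lemma mpolys_in_1: "(1 :: ('v, 'k::zero_neq_one) mpoly) \<in> mpolys_in V"
  by (simp add: mpolys_in_def)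

lemma mpolys_in_Var: "v \<in> V \<Longrightarrow> (Var v :: ('v, 'k::zero_neq_one) mpoly) \<in> mpolys_in V"
  by (simp add: mpolys_in_def Var_def)

lemma mpolys_in_mult: "P \<in> mpolys_in V \<Longrightarrow> Q \<in> mpolys_in V \<Longrightarrow> P * Q \<in> mpolys_in V"
  for P Q :: "('v, 'k::comm_semiring_1) mpoly"
proof -
  assume P: "P \<in> mpolys_in V" and Q: "Q \<in> mpolys_in V"
  show ?thesis
    unfolding mpolys_in_def
  proof (intro CollectI ballI)
    fix t assume "t \<in> Poly_Mapping.keys (P * Q)"
    then obtain a b where "a \<in> Poly_Mapping.keys P" "b \<in> Poly_Mapping.keys Q" "t = a + b"
      using Poly_Mapping.keys_mult[of P Q] by blast
    moreover have "Poly_Mapping.keys (a + b) \<subseteq> Poly_Mapping.keys a \<union> Poly_Mapping.keys b"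
      by (rule Poly_Mapping.keys_add)
    ultimately show "Poly_Mapping.keys t \<subseteq> V"
      using P Q by (fastforce simp: mpolys_in_def)
  qed
qed

lemma mpolys_in_uminus: "P \<in> mpolys_in V \<Longrightarrow> - P \<in> mpolys_in V"
  for P :: "('v, 'k::ab_group_add) mpoly"
  by (simp add: mpolys_in_def in_keys_iff)

lemma mpolys_in_diff: "P \<in> mpolys_in V \<Longrightarrow> Q \<in> mpolys_in V \<Longrightarrow> P - Q \<in> mpolys_in V"
  for P Q :: "('v, 'k::ab_group_add) mpoly"
  using mpolys_in_add[of P V "- Q"] mpolys_in_uminus[of Q V] by simp

lemma mpolys_in_power: "P \<in> mpolys_in V \<Longrightarrow> P ^ n \<in> mpolys_in V"
  for P :: "('v, 'k::comm_semiring_1) mpoly"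
  by (induction n) (auto intro: mpolys_in_mult mpolys_in_1)

lemma mpolys_in_sum: "(\<And>i. i \<in> I \<Longrightarrow> F i \<in> mpolys_in V) \<Longrightarrow> sum F I \<in> mpolys_in V"
  for F :: "_ \<Rightarrow> ('v, 'k::comm_monoid_add) mpoly"
  by (induction I rule: infinite_finite_induct) (auto intro: mpolys_in_add mpolys_in_0)

lemmas mpolys_in_intros = mpolys_in_add mpolys_in_Const mpolys_in_0 mpolys_in_1 mpolys_in_Var
  mpolys_in_mult mpolys_in_uminus mpolys_in_diff mpolys_in_power mpolys_in_sum

lemma poly_mapping_sum_single:
  "P = (\<Sum>t\<in>Poly_Mapping.keys P. Poly_Mapping.single t (Poly_Mapping.lookup P t))"
  by (rule poly_mapping_eqI)
    (auto simp: lookup_sum lookup_single when_def in_keys_iff)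

lemma Const_0 [simp]: "Const 0 = 0"
  by (simp add: Const_def)

lemma Const_1 [simp]: "Const 1 = 1"
  by (simp add: Const_def)

lemma Const_add: "Const (a + b) = Const a + Const b"
  by (simp add: Const_def single_add)

lemma Const_mult: "Const (a * b) = Const a * (Const b :: ('v, 'k::comm_semiring_1) mpoly)"
  by (simp add: Const_def mult_single)

lemma Var_power: "(Var v :: ('v, 'k::comm_semiring_1) mpoly) ^ n
    = Poly_Mapping.single (Poly_Mapping.single v n) 1"
  by (induction n) (simp_all add: Var_def mult_single flip: single_add)

lemma update_eq_add_single:
  fixes f :: "'a \<Rightarrow>\<^sub>0 'b::comm_monoid_add"
  assumes "a \<notin> Poly_Mapping.keys f"
  shows "Poly_Mapping.update a b f = Poly_Mapping.single a b + f"
  using assms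
  by (intro poly_mapping_eqI) (auto simp: lookup_update lookup_add lookup_single when_def in_keys_iff)

text \<open>Monomials are built up one factor at a time, so that the later reduction only has to
  multiply by a single generator.\<close>

lemma monomial_induct [consumes 1, case_names one Var_mult]:
  fixes t :: "'v \<Rightarrow>\<^sub>0 nat" and Q :: "('v, 'k::comm_semiring_1) mpoly \<Rightarrow> bool"
  assumes "Poly_Mapping.keys t \<subseteq> V" and one: "Q 1"
    and step: "\<And>v M. v \<in> V \<Longrightarrow> M \<in> mpolys_in V \<Longrightarrow> Q M \<Longrightarrow> Q (Var v * M)"
  shows "Q (Poly_Mapping.single t 1)"
  using assms(1)
proof (induction t rule: update_induct)
  case const
  then show ?case using one by simp
next
  case (update f a b)
  have keys: "Poly_Mapping.keys f \<subseteq> V" "a \<in> V"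
    using update by (auto simp: keys_update split: if_splits)
  have M: "(Poly_Mapping.single f 1 :: ('v, 'k) mpoly) \<in> mpolys_in V"
    using keys by (simp add: mpolys_in_def)
  \<comment> \<open>The update brings in the fresh variable \<open>a\<close> with its full exponent
    \<open>b\<close>; the inner induction splits \<open>Var a ^ b\<close> into single
    factors.\<close>
  have "Q (Var a ^ n * Poly_Mapping.single f 1)" for n
  proof (induction n)
    case 0
    then show ?case using update keys by simp
  next
    case (Suc n)
    show ?case
      unfolding power_Suc mult.assoc
      by (intro step Suc keys mpolys_in_mult mpolys_in_power mpolys_in_Var M)
  qed
  from this[of b] show ?case
    using update by (simp add: Var_power mult_single update_eq_add_single)
qed

section \<open>Evaluation as an algebra homomorphism\<close>

definition monom_eval :: "('v \<Rightarrow> 'k::field poly) \<Rightarrow> ('v \<Rightarrow>\<^sub>0 nat) \<Rightarrow> 'k poly" where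
  "monom_eval a t = (\<Prod>v\<in>Poly_Mapping.keys t. a v ^ Poly_Mapping.lookup t v)"

text \<open>Extra variables have exponent 0, so two monomials can be evaluated over a common index
  set.\<close>

lemma monom_eval_superset:
  assumes "finite S" "Poly_Mapping.keys t \<subseteq> S"
  shows "monom_eval a t = (\<Prod>v\<in>S. a v ^ Poly_Mapping.lookup t v)"
  unfolding monom_eval_def using assms
  by (intro prod.mono_neutral_left) (auto simp: in_keys_iff)

lemma monom_eval_add: "monom_eval a (s + t) = monom_eval a s * monom_eval a t"
proof -
  let ?S = "Poly_Mapping.keys s \<union> Poly_Mapping.keys t"
  have "Poly_Mapping.keys (s + t) \<subseteq> ?S"
    by (rule Poly_Mapping.keys_add)
  then show ?thesis
    by (simp add: monom_eval_superset[of ?S] lookup_add power_add prod.distrib)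
qed

text \<open>Terms outside the support contribute 0. A common \<open>S\<close> serves for a sum and
  its summands, although cancellation may shrink the support of the sum.\<close>

lemma meval_superset:
  assumes "finite S" "Poly_Mapping.keys P \<subseteq> S"
  shows "meval a P = (\<Sum>t\<in>S. smult (Poly_Mapping.lookup P t) (monom_eval a t))"
  unfolding meval_def monom_eval_def using assms
  by (intro sum.mono_neutral_left) (auto simp: in_keys_iff)

lemma meval_add: "meval a (P + Q) = meval a P + meval a Q"
proof -
  let ?S = "Poly_Mapping.keys P \<union> Poly_Mapping.keys Q"
  have "Poly_Mapping.keys (P + Q) \<subseteq> ?S"
    by (rule Poly_Mapping.keys_add)
  then show ?thesis
    by (simp add: meval_superset[of ?S] lookup_add smult_add_left sum.distrib)
qed

lemma meval_0 [simp]: "meval a 0 = 0"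
  by (simp add: meval_def)

lemma meval_sum: "meval a (sum F I) = (\<Sum>i\<in>I. meval a (F i))"
  by (induction I rule: infinite_finite_induct) (simp_all add: meval_add)

lemma meval_single: "meval a (Poly_Mapping.single t c) = smult c (monom_eval a t)"
  by (subst meval_superset[of "{t}"]) auto

text \<open>Expanding both factors into monomials reduces the claim to
  \<open>monom_eval_add\<close>.\<close>

lemma meval_mult: "meval a (P * Q) = meval a P * meval a Q"
proof -
  have "meval a (P * Q) = meval a
      ((\<Sum>s\<in>Poly_Mapping.keys P. Poly_Mapping.single s (Poly_Mapping.lookup P s)) *
       (\<Sum>t\<in>Poly_Mapping.keys Q. Poly_Mapping.single t (Poly_Mapping.lookup Q t)))"
    by (simp flip: poly_mapping_sum_single)
  also have "\<dots> = (\<Sum>s\<in>Poly_Mapping.keys P. \<Sum>t\<in>Poly_Mapping.keys Q.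
      smult (Poly_Mapping.lookup P s) (monom_eval a s) *
      smult (Poly_Mapping.lookup Q t) (monom_eval a t))"
    by (simp add: sum_product meval_sum mult_single meval_single monom_eval_add mult_ac)
  also have "\<dots> = meval a P * meval a Q"
    unfolding sum_product[symmetric]
    by (simp flip: meval_superset[OF finite_keys subset_refl])
  finally show ?thesis .
qed

lemma meval_diff: "meval a (P - Q) = meval a P - meval a Q"
  by (metis add_diff_cancel_right' diff_add_cancel meval_add)

lemma meval_Const: "meval a (Const c) = [:c:]"
  by (simp add: Const_def meval_single monom_eval_def)

lemma meval_Var: "meval a (Var v) = a v"
  by (simp add: Var_def meval_single monom_eval_def)

lemma meval_1: "meval a 1 = 1"
  using meval_Const[of a 1] by (simp add: one_pCons)

lemma meval_power: "meval a (P ^ n) = meval a P ^ n"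
  by (induction n) (simp_all add: meval_mult meval_1)

subsection \<open>Ideals\<close>

text \<open>Cofactors extended by 0 outside \<open>S\<close> let two representations be added over
  the union of their index sets.\<close>

lemma mideal_in_iff_restrict:
  "P \<in> mideal_in V R \<longleftrightarrow> (\<exists>S q. finite S \<and> S \<subseteq> R \<and> (\<forall>r. q r \<in> mpolys_in V) \<and>
     (\<forall>r. r \<notin> S \<longrightarrow> q r = 0) \<and> P = (\<Sum>r\<in>S. q r * r))" (is "_ \<longleftrightarrow> ?rhs")
proof
  assume "P \<in> mideal_in V R"
  then obtain S q where *: "finite S" "S \<subseteq> R" "\<forall>r\<in>S. q r \<in> mpolys_in V" "P = (\<Sum>r\<in>S. q r * r)"
    unfolding mideal_in_def by blast
  then show ?rhs
    by (intro exI[of _ S] exI[of _ "\<lambda>r. if r \<in> S then q r else 0"])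
      (auto intro: mpolys_in_0)
qed (auto simp: mideal_in_def)

lemma mideal_in_add:
  assumes "P \<in> mideal_in V R" "Q \<in> mideal_in V R"
  shows "P + Q \<in> mideal_in V R"
proof -
  obtain S q where S: "finite S" "S \<subseteq> R" "\<And>r. q r \<in> mpolys_in V" "\<And>r. r \<notin> S \<Longrightarrow> q r = 0"
    "P = (\<Sum>r\<in>S. q r * r)"
    using assms(1) unfolding mideal_in_iff_restrict by blast
  obtain T p where T: "finite T" "T \<subseteq> R" "\<And>r. p r \<in> mpolys_in V" "\<And>r. r \<notin> T \<Longrightarrow> p r = 0"
    "Q = (\<Sum>r\<in>T. p r * r)"
    using assms(2) unfolding mideal_in_iff_restrict by blast
  have "P = (\<Sum>r\<in>S \<union> T. q r * r)"
    unfolding S(5) using S T by (intro sum.mono_neutral_left) auto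
  moreover have "Q = (\<Sum>r\<in>S \<union> T. p r * r)"
    unfolding T(5) using S T by (intro sum.mono_neutral_left) auto
  ultimately have "P + Q = (\<Sum>r\<in>S \<union> T. (q r + p r) * r)"
    by (simp add: sum.distrib distrib_right)
  then show ?thesis
    unfolding mideal_in_def using S T
    by (intro CollectI exI[of _ "S \<union> T"] exI[of _ "\<lambda>r. q r + p r"])
      (auto intro: mpolys_in_add)
qed

lemma mideal_in_mult_left:
  assumes "P \<in> mideal_in V R" "Q \<in> mpolys_in V"
  shows "Q * P \<in> mideal_in V R"
proof -
  obtain S q where S: "finite S" "S \<subseteq> R" "\<forall>r\<in>S. q r \<in> mpolys_in V" "P = (\<Sum>r\<in>S. q r * r)"
    using assms(1) unfolding mideal_in_def by blast
  then have "Q * P = (\<Sum>r\<in>S. (Q * q r) * r)"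
    by (simp add: sum_distrib_left mult.assoc)
  then show ?thesis
    unfolding mideal_in_def using S assms(2)
    by (intro CollectI exI[of _ S] exI[of _ "\<lambda>r. Q * q r"]) (auto intro: mpolys_in_mult)
qed

lemma mideal_in_0: "0 \<in> mideal_in V R"
  unfolding mideal_in_def by (intro CollectI exI[of _ "{}"]) auto

lemma mideal_in_base: "r \<in> R \<Longrightarrow> r \<in> mideal_in V R"
  unfolding mideal_in_def
  by (intro CollectI exI[of _ "{r}"] exI[of _ "\<lambda>_. 1"]) (auto intro: mpolys_in_1)

lemma mideal_in_subset_mpolys_in: "R \<subseteq> mpolys_in V \<Longrightarrow> mideal_in V R \<subseteq> mpolys_in V"
  unfolding mideal_in_def by (blast intro: mpolys_in_sum mpolys_in_mult)

lemma meval_mideal_in_eq_0: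
  assumes "\<And>r. r \<in> R \<Longrightarrow> meval a r = 0" "P \<in> mideal_in V R"
  shows "meval a P = 0"
  using assms(2) unfolding mideal_in_def
  by (auto simp: meval_sum meval_mult assms(1) subset_iff intro!: sum.neutral)

subsection \<open>Brackets\<close>

lemma low_order_eq_monom_mult:
  fixes p :: "'k::comm_semiring_1 poly"
  assumes "\<And>j. j < n \<Longrightarrow> coeff p j = 0"
  shows "p = monom 1 n * poly_shift n p"
  using assms by (auto simp: poly_eq_iff coeff_monom_mult coeff_poly_shift)

lemma poly_shift_monom_mult: "poly_shift n (monom 1 n * p) = (p :: 'k::comm_semiring_1 poly)"
  by (simp add: poly_eq_iff coeff_poly_shift coeff_monom_mult)

text \<open>
  The bracket of \<open>x\<^sup>m q\<close>, as a single sum over the coefficients of \<open>q\<close>. Unlike \<open>bracket\<close> it forgets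
  nothing about its argument, and multiplication by \<open>GX 0\<close> becomes multiplication by \<open>x\<^sup>m\<close>.
\<close>

definition tail :: "nat \<Rightarrow> 'k::field poly \<Rightarrow> (gen, 'k) mpoly" where
  "tail m q = (\<Sum>n\<le>degree q. Const (coeff q n) * (Var (GX 0) ^ (n div m) * Var (GX (n mod m))))"

lemma tail_superset:
  assumes "degree q < N"
  shows "tail m q = (\<Sum>n<N. Const (coeff q n) * (Var (GX 0) ^ (n div m) * Var (GX (n mod m))))"
  unfolding tail_def using assms
  by (intro sum.mono_neutral_left) (auto simp: coeff_eq_0)

text \<open>Writing \<open>n = i + m * k\<close> with \<open>i < m\<close> merges the double sum
  into one sum over \<open>n\<close>, cut into blocks of length \<open>m\<close>.\<close>

lemma bracket_eq_tail:
  assumes "m > 0"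
  shows "bracket m p = tail m (poly_shift m p)"
proof -
  let ?g = "\<lambda>n. Const (coeff p (m + n)) * (Var (GX 0) ^ (n div m) * Var (GX (n mod m))) :: (gen, 'a) mpoly"
  have "bracket m p = (\<Sum>i<m. \<Sum>k\<le>degree p. ?g (i + m * k))"
    unfolding bracket_def sum_distrib_right by (simp add: ac_simps)
  also have "\<dots> = (\<Sum>k<Suc (degree p). \<Sum>i<m. ?g (i + m * k))"
    by (subst sum.swap) (simp add: lessThan_Suc_atMost)
  also have "\<dots> = (\<Sum>k<Suc (degree p). sum ?g {k * m..<k * m + m})"
  proof (rule sum.cong[OF refl])
    fix k
    show "(\<Sum>i<m. ?g (i + m * k)) = sum ?g {k * m..<k * m + m}"
      by (rule sum.reindex_bij_witness[of _ "\<lambda>n. n - m * k" "\<lambda>i. i + m * k"])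
        (auto simp: mult.commute)
  qed
  also have "\<dots> = sum ?g {..<Suc (degree p) * m}"
    by (rule sum.nat_group)
  also have "\<dots> = tail m (poly_shift m p)"
  \<comment> \<open>The blocks reach beyond the degree of the shifted polynomial, where its
    coefficients are 0.\<close>
  proof (subst tail_superset[where N = "Suc (degree p) * m"])
    have "degree (poly_shift m p) \<le> degree p"
      by (rule degree_le) (simp add: coeff_poly_shift coeff_eq_0)
    also have "\<dots> < Suc (degree p) * m"
      using assms by (cases m) simp_all
    finally show "degree (poly_shift m p) < Suc (degree p) * m" .
  qed (simp add: coeff_poly_shift add.commute)
  finally show ?thesis .
qed

lemma tail_eq_bracket: "m > 0 \<Longrightarrow> tail m q = bracket m (monom 1 m * q)"
  by (simp add: bracket_eq_tail poly_shift_monom_mult)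

section \<open>Linearity and values of tails\<close>

lemma tail_0 [simp]: "tail m 0 = 0"
  by (simp add: tail_def)

lemma tail_add: "tail m (p + q) = tail m p + tail m q"
proof -
  define N where "N = Suc (max (degree p) (degree q))"
  have "degree (p + q) < N" "degree p < N" "degree q < N"
    using degree_add_le_max[of p q] by (auto simp: N_def)
  then show ?thesis
    by (simp add: tail_superset[of _ N] Const_add distrib_right sum.distrib)
qed

lemma tail_smult: "tail m (smult c p) = Const c * tail m p"
  using degree_smult_le[of c p]
  by (simp add: tail_superset[of _ "Suc (degree p)"] Const_mult sum_distrib_left mult.assoc
      del: sum.lessThan_Suc)

lemma tail_monom: "tail m (monom 1 n) = Var (GX 0) ^ (n div m) * Var (GX (n mod m))"
proof -
  have "tail m (monom 1 n) = (\<Sum>i<Suc n. if i = n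
      then Var (GX 0) ^ (n div m) * Var (GX (n mod m)) else 0)"
    by (subst tail_superset[of _ "Suc n"]) (auto simp: degree_monom_eq intro!: sum.cong)
  then show ?thesis by simp
qed

lemma tail_monom_block: "i < m \<Longrightarrow> tail m (monom 1 (i + m * k)) = Var (GX 0) ^ k * Var (GX i)"
  by (simp add: tail_monom)

lemma tail_in_mpolys_in: "m > 0 \<Longrightarrow> tail m q \<in> mpolys_in (gens m)"
  unfolding tail_def by (intro mpolys_in_intros) (auto simp: gens_def)

lemma bracket_in_mpolys_in: "m > 0 \<Longrightarrow> bracket m p \<in> mpolys_in (gens m)"
  by (simp add: bracket_eq_tail tail_in_mpolys_in)

lemma meval_bracket:
  assumes "m > 0"
  shows "meval (gen_val m f) (bracket m p) = p - poly_cutoff m p"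
  using bracket_decomposition[OF assms, of p]
  by (simp add: bracket_def meval_sum meval_mult meval_Const meval_power meval_Var algebra_simps)

lemma meval_tail: "m > 0 \<Longrightarrow> meval (gen_val m f) (tail m q) = monom 1 m * q"
  by (simp add: tail_eq_bracket meval_bracket)
    (simp add: poly_eq_iff coeff_poly_cutoff coeff_monom_mult)

text \<open>Rewriting rules for \<open>tail\<close> are compatible with sums and scalars, so by this
  rule they need to be checked on monomials only.\<close>

lemma poly_linear_induct [case_names monom add smult]:
  fixes q :: "'k::comm_semiring_1 poly"
  assumes "\<And>n. Q (monom 1 n)" "\<And>p q. Q p \<Longrightarrow> Q q \<Longrightarrow> Q (p + q)" "\<And>c p. Q p \<Longrightarrow> Q (smult c p)"
  shows "Q q"
proof -
  \<comment> \<open>The zero polynomial arises as 0 times a monomial.\<close>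
  have "Q 0" using assms(3)[OF assms(1), of 0] by simp
  have "Q (\<Sum>i\<in>I. monom (coeff q i) i)" if "finite I" for I
    using that
  proof (induction rule: finite_induct)
    case (insert i I)
    have "Q (monom (coeff q i) i)"
      using assms(3)[OF assms(1), of "coeff q i" i] by (simp add: smult_monom)
    then show ?case using insert assms(2) by simp
  qed (simp add: \<open>Q 0\<close>)
  from this[of "{..degree q}"] show ?thesis
    by (simp add: poly_as_sum_of_monoms)
qed

subsection \<open>Reduction to normal form\<close>

text \<open>The reduction works modulo any ideal that contains the three kinds of relations. Since
  \<open>tail m q\<close> stands for x^m q, the products x^(m+i) x^(m+j) and x^(m+i) f appear on the
  right with one factor x^m removed; \<open>g\<close> will be f^K divided by x^m.\<close>

context
  fixes m K :: nat and f g :: "'k::field poly" and R :: "(gen, 'k) mpoly set"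
  assumes m: "m > 0" and K: "K > 0"
    and rel_F: "Var GF ^ K - tail m g \<in> mideal_in (gens m) R"
    and rel_XX: "\<And>i j. i < m \<Longrightarrow> j < m \<Longrightarrow>
      Var (GX i) * Var (GX j) - tail m (monom 1 (m + i + j)) \<in> mideal_in (gens m) R"
    and rel_XF: "\<And>i. i < m \<Longrightarrow>
      Var (GX i) * Var GF - tail m (monom 1 i * f) \<in> mideal_in (gens m) R"
begin

private definition eqv :: "(gen, 'k) mpoly \<Rightarrow> (gen, 'k) mpoly \<Rightarrow> bool" (infix "\<approx>" 50) where
  "P \<approx> Q \<longleftrightarrow> P - Q \<in> mideal_in (gens m) R"

private lemma eqv_refl: "P \<approx> P"
  by (simp add: eqv_def mideal_in_0)

private lemma eqv_trans [trans]: "P \<approx> Q \<Longrightarrow> Q \<approx> S \<Longrightarrow> P \<approx> S"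
  unfolding eqv_def using mideal_in_add[of "P - Q" "gens m" R "Q - S"] by simp

private lemma eqv_add: "P \<approx> Q \<Longrightarrow> P' \<approx> Q' \<Longrightarrow> P + P' \<approx> Q + Q'"
  unfolding eqv_def using mideal_in_add[of "P - Q" "gens m" R "P' - Q'"]
  by (simp add: algebra_simps)

text \<open>The factor \<open>S\<close> is confined to the generators because the ideal admits only
  such cofactors.\<close>

private lemma eqv_mult: "P \<approx> Q \<Longrightarrow> S \<in> mpolys_in (gens m) \<Longrightarrow> S * P \<approx> S * Q"
  unfolding eqv_def using mideal_in_mult_left[of "P - Q" "gens m" R S]
  by (simp add: algebra_simps)

text \<open>An equality and not merely a congruence: a factor \<open>Var (GX 0)\<close> raises
  \<open>n div m\<close> by one and keeps \<open>n mod m\<close>.\<close>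

private lemma X0_power_tail: "Var (GX 0) ^ k * tail m q = tail m (monom 1 (m * k) * q)"
proof (induction q rule: poly_linear_induct)
  case (monom n)
  then show ?case
    using m by (simp add: tail_monom mult_monom power_add mult.assoc)
qed (simp_all add: tail_add tail_smult distrib_left mult.left_commute)

text \<open>
  A basis monomial of a tail is \<open>GX 0 ^ k * GX i\<close> with \<open>i < m\<close>, so a relation rewriting \<open>v * GX i\<close> to a
  tail suffices to rewrite all products of \<open>v\<close> with tails.
\<close>

private lemma gen_tail:
  assumes v: "v \<in> gens m"
    and gen: "\<And>i. i < m \<Longrightarrow> Var v * Var (GX i) \<approx> tail m (monom 1 i * h)"
  shows "Var v * tail m q \<approx> tail m (h * q)"
proof (induction q rule: poly_linear_induct)
  case (monom n)
  define i k where "i = n mod m" and "k = n div m"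
  have n: "n = i + m * k" and i: "i < m"
    using m by (auto simp: i_def k_def)
  have "Var v * tail m (monom 1 n) = Var (GX 0) ^ k * (Var v * Var (GX i) :: (gen, 'k) mpoly)"
    unfolding n tail_monom_block[OF i] by (rule mult.left_commute)
  also have "\<dots> \<approx> Var (GX 0) ^ k * tail m (monom 1 i * h)"
    using m by (intro eqv_mult gen i mpolys_in_intros) (auto simp: gens_def)
  also have "\<dots> = tail m (h * monom 1 n)"
    by (simp add: X0_power_tail n mult_monom flip: mult.assoc)
      (simp add: ac_simps)
  finally show ?case .
next
  case (add p q)
  then show ?case
    by (simp add: tail_add distrib_left eqv_add)
next
  case (smult c p)
  show ?case
    using eqv_mult[OF smult, of "Const c"]
    by (simp add: tail_smult mpolys_in_Const mult.left_commute)
qed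

text \<open>The case of \<open>gen_tail\<close> in which \<open>h\<close> is the value x^(m+j) of
  the generator.\<close>

private lemma X_tail: "j < m \<Longrightarrow> Var (GX j) * tail m q \<approx> tail m (monom 1 (m + j) * q)"
  using rel_XX[of j]
  by (intro gen_tail) (auto simp: gens_def eqv_def mult_monom ac_simps)

private lemma F_tail: "Var GF * tail m q \<approx> tail m (f * q)"
  using rel_XF by (intro gen_tail) (auto simp: gens_def eqv_def ac_simps)

text \<open>\<open>Var (GX j)\<close> is itself the tail of x^j, and \<open>F_tail\<close> absorbs
  each further factor \<open>Var GF\<close>.\<close>

private lemma X_F_power:
  assumes j: "j < m"
  shows "Var (GX j) * Var GF ^ a \<approx> tail m (monom 1 j * f ^ a)"
proof (induction a)
  case 0
  then show ?case
    using j by (simp add: tail_monom eqv_refl)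
next
  case (Suc a)
  have "Var (GX j) * Var GF ^ Suc a = Var GF * (Var (GX j) * Var GF ^ a :: (gen, 'k) mpoly)"
    by (simp add: ac_simps)
  also have "\<dots> \<approx> Var GF * tail m (monom 1 j * f ^ a)"
    by (intro eqv_mult Suc mpolys_in_Var) (simp add: gens_def)
  also have "\<dots> \<approx> tail m (monom 1 j * f ^ Suc a)"
    using F_tail[of "monom 1 j * f ^ a"] by (simp add: ac_simps)
  finally show ?case .
qed

text \<open>The alternative survives multiplication by a generator: tails absorb every generator,
  and a power of \<open>Var GF\<close> turns into a tail when it meets some
  \<open>Var (GX j)\<close> or reaches the exponent \<open>K\<close>.\<close>

private lemma monomial_normal_form:
  assumes "Poly_Mapping.keys t \<subseteq> gens m"
  shows "(\<exists>a<K. Poly_Mapping.single t 1 \<approx> Var GF ^ a) \<or> (\<exists>q. Poly_Mapping.single t 1 \<approx> tail m q)"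
  using assms
proof (induction rule: monomial_induct)
  case one
  \<comment> \<open>The monomial 1 is \<open>Var GF ^ 0\<close>, an admissible power because
    \<open>K\<close> is positive.\<close>
  then show ?case using K eqv_refl[of 1] by (auto intro!: exI[of _ 0])
next
  case (Var_mult v M)
  note v = mpolys_in_Var[OF \<open>v \<in> gens m\<close>]
  from Var_mult.IH consider a where "a < K" "M \<approx> Var GF ^ a" | q where "M \<approx> tail m q"
    by blast
  then show ?case
  proof cases
    case (1 a)
    then have *: "Var v * M \<approx> Var v * Var GF ^ a"
      by (intro eqv_mult v)
    show ?thesis
    proof (cases v)
      case GF
      with * have *: "Var v * M \<approx> Var GF ^ Suc a" by simp
      show ?thesis
      proof (cases "Suc a < K")
        case False
        \<comment> \<open>The exponent grows by one at a time, so it meets \<open>K\<close> exactly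
          and \<open>rel_F\<close> applies to the whole power.\<close>
        with 1 have "Suc a = K" by simp
        then have "Var GF ^ Suc a \<approx> tail m g"
          using rel_F by (simp add: eqv_def)
        then show ?thesis using * eqv_trans by blast
      qed (use * in blast)
    next
      case (GX j)
      then have "Var v * Var GF ^ a \<approx> tail m (monom 1 j * f ^ a)"
        using X_F_power[of j a] \<open>v \<in> gens m\<close> by (auto simp: gens_def)
      then show ?thesis using * eqv_trans by blast
    qed
  next
    case (2 q)
    then have "Var v * M \<approx> Var v * tail m q"
      by (intro eqv_mult v)
    moreover have "\<exists>h. Var v * tail m q \<approx> tail m h"
      using \<open>v \<in> gens m\<close> X_tail F_tail by (cases v) (auto simp: gens_def)
    ultimately show ?thesis using eqv_trans by blast
  qed
qed

text \<open>Closure under sums and constant multiples extends the alternative for monomials to all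
  polynomials.\<close>

private definition reducible :: "(gen, 'k) mpoly \<Rightarrow> bool" where
  "reducible P \<longleftrightarrow> (\<exists>c q. P \<approx> (\<Sum>a<K. Const (c a) * Var GF ^ a) + tail m q)"

private lemma reducible_add: "reducible P \<Longrightarrow> reducible Q \<Longrightarrow> reducible (P + Q)"
proof -
  assume "reducible P" "reducible Q"
  then obtain c q d r where "P \<approx> (\<Sum>a<K. Const (c a) * Var GF ^ a) + tail m q"
      "Q \<approx> (\<Sum>a<K. Const (d a) * Var GF ^ a) + tail m r"
    unfolding reducible_def by blast
  from eqv_add[OF this]
  have "P + Q \<approx> (\<Sum>a<K. Const (c a + d a) * Var GF ^ a) + tail m (q + r)"
    by (simp add: Const_add tail_add distrib_right sum.distrib add_ac)
  then show ?thesis unfolding reducible_def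
    by (intro exI[of _ "\<lambda>a. c a + d a"] exI[of _ "q + r"])
qed

private lemma reducible_Const_mult: "reducible P \<Longrightarrow> reducible (Const b * P)"
proof -
  assume "reducible P"
  then obtain c q where "P \<approx> (\<Sum>a<K. Const (c a) * Var GF ^ a) + tail m q"
    unfolding reducible_def by blast
  from eqv_mult[OF this mpolys_in_Const[of b]]
  have "Const b * P \<approx> (\<Sum>a<K. Const (b * c a) * Var GF ^ a) + tail m (smult b q)"
    by (simp add: Const_mult tail_smult distrib_left sum_distrib_left mult.assoc)
  then show ?thesis unfolding reducible_def
    by (intro exI[of _ "\<lambda>a. b * c a"] exI[of _ "smult b q"])
qed

private lemma reducible_0: "reducible 0"
  unfolding reducible_def using eqv_refl[of 0] by (intro exI[of _ "\<lambda>_. 0"] exI[of _ 0]) simp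

private lemma reducible_monomial:
  assumes "Poly_Mapping.keys t \<subseteq> gens m"
  shows "reducible (Poly_Mapping.single t 1)"
  using monomial_normal_form[OF assms]
proof
  assume "\<exists>a<K. Poly_Mapping.single t 1 \<approx> Var GF ^ a"
  then obtain a where a: "a < K" "Poly_Mapping.single t 1 \<approx> Var GF ^ a" by blast
  have "(\<Sum>b<K. Const (if b = a then 1 else 0) * Var GF ^ b)
      = (\<Sum>b<K. if b = a then Var GF ^ a else 0 :: (gen, 'k) mpoly)"
    by (intro sum.cong) auto
  with a show ?thesis
    unfolding reducible_def
    by (intro exI[of _ "\<lambda>b. if b = a then 1 else 0"] exI[of _ 0]) simp
next
  assume "\<exists>q. Poly_Mapping.single t 1 \<approx> tail m q"
  then obtain q where "Poly_Mapping.single t 1 \<approx> tail m q" by blast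
  then show ?thesis
    unfolding reducible_def by (intro exI[of _ "\<lambda>_. 0"] exI[of _ q]) simp
qed

lemma normal_form:
  assumes P: "P \<in> mpolys_in (gens m)"
  shows "\<exists>c q. P - ((\<Sum>a<K. Const (c a) * Var GF ^ a) + tail m q) \<in> mideal_in (gens m) R"
proof -
  \<comment> \<open>Keeping the coefficients of \<open>P\<close> fixed while \<open>T\<close> grows
    allows an induction over parts of the support.\<close>
  have "reducible (\<Sum>t\<in>T. Const (Poly_Mapping.lookup P t) * Poly_Mapping.single t 1)"
    if "finite T" "T \<subseteq> Poly_Mapping.keys P" for T
    using that
  proof (induction rule: finite_induct)
    case (insert t T)
    then have "reducible (Const (Poly_Mapping.lookup P t) * Poly_Mapping.single t 1)"
      using P by (intro reducible_Const_mult reducible_monomial) (auto simp: mpolys_in_def)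
    then show ?case
      using insert by (simp add: reducible_add)
  qed (simp add: reducible_0)
  from this[of "Poly_Mapping.keys P"] have "reducible P"
    by (simp add: Const_def mult_single flip: poly_mapping_sum_single)
  then show ?thesis
    by (simp add: reducible_def eqv_def)
qed

end

subsection \<open>The canonical basis\<close>

lemma vector_space_smult: "vector_space (smult :: 'k::field \<Rightarrow> _)"
  by unfold_locales (simp_all add: smult_add_right smult_add_left)

lemma
  assumes "A \<in> AA m"
  shows AA_add: "\<And>p q. p \<in> A \<Longrightarrow> q \<in> A \<Longrightarrow> p + q \<in> A"
    and AA_smult: "\<And>c p. p \<in> A \<Longrightarrow> smult c p \<in> A"
    and AA_0: "0 \<in> A"
    and AA_diff: "\<And>p q. p \<in> A \<Longrightarrow> q \<in> A \<Longrightarrow> p - q \<in> A"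
    and AA_1: "1 \<in> A"
    and AA_mult: "\<And>p q. p \<in> A \<Longrightarrow> q \<in> A \<Longrightarrow> p * q \<in> A"
    and AA_monom_mult: "\<And>q. monom 1 m * q \<in> A"
proof -
  interpret vector_space "smult :: 'a \<Rightarrow> _"
    by (rule vector_space_smult)
  have "subspace A" and "1 \<in> A" "\<forall>p\<in>A. \<forall>q\<in>A. p * q \<in> A" "range (\<lambda>q. monom 1 m * q) \<subseteq> A"
    using assms by (auto simp: AA_def is_subalgebra_def)
  then show "\<And>p q. p \<in> A \<Longrightarrow> q \<in> A \<Longrightarrow> p + q \<in> A" "\<And>c p. p \<in> A \<Longrightarrow> smult c p \<in> A" "0 \<in> A"
    "\<And>p q. p \<in> A \<Longrightarrow> q \<in> A \<Longrightarrow> p - q \<in> A" "1 \<in> A" "\<And>p q. p \<in> A \<Longrightarrow> q \<in> A \<Longrightarrow> p * q \<in> A"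
    "\<And>q. monom 1 m * q \<in> A"
    by (auto intro: subspace_add subspace_scale subspace_0 subspace_diff)
qed

section \<open>Membership in \<open>A\<close> and orders of its elements\<close>

lemma AA_sum:
  assumes "A \<in> AA m" "\<And>i. i \<in> I \<Longrightarrow> F i \<in> A"
  shows "sum F I \<in> A"
  using assms(2)
  by (induction I rule: infinite_finite_induct) (auto intro: AA_0[OF assms(1)] AA_add[OF assms(1)])

lemma AA_power:
  assumes "A \<in> AA m" "p \<in> A"
  shows "p ^ n \<in> A"
  by (induction n) (auto intro: AA_1[OF assms(1)] AA_mult[OF assms(1)] assms(2))

lemma AA_high_order:
  assumes "A \<in> AA m" "\<And>j. j < m \<Longrightarrow> coeff p j = 0"
  shows "p \<in> A"
  using AA_monom_mult[OF assms(1), of "poly_shift m p"] low_order_eq_monom_mult[OF assms(2)]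
  by simp

text \<open>The part cut off lies in x^m K[x], hence in \<open>A\<close>.\<close>

lemma AA_poly_cutoff:
  assumes A: "A \<in> AA m" and p: "p \<in> A"
  shows "poly_cutoff m p \<in> A"
proof -
  have "p - poly_cutoff m p \<in> A"
    by (rule AA_high_order[OF A]) (simp add: coeff_poly_cutoff)
  from AA_diff[OF A p this] show ?thesis by simp
qed

text \<open>As truncation stays inside \<open>A\<close>, the quotient can be handled as a subspace
  of \<open>A\<close>.\<close>

lemma Abar_eq:
  assumes A: "A \<in> AA m"
  shows "Abar m A = {p \<in> A. \<forall>j\<ge>m. coeff p j = 0}" (is "_ = ?B")
proof
  show "Abar m A \<subseteq> ?B"
    by (auto simp: Abar_def coeff_poly_cutoff AA_poly_cutoff[OF A])
  show "?B \<subseteq> Abar m A"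
  proof
    fix p assume p: "p \<in> ?B"
    then have "p = poly_cutoff m p"
      by (auto simp: poly_eq_iff coeff_poly_cutoff)
    with p show "p \<in> Abar m A" unfolding Abar_def by blast
  qed
qed

text \<open>Dividing by the lowest coefficient gives the normalised element that \<open>Gam\<close>
  asks for.\<close>

lemma order_in_Gam:
  assumes A: "A \<in> AA m" and p: "p \<in> A" "coeff p n \<noteq> 0" "\<And>j. j < n \<Longrightarrow> coeff p j = 0"
    and n: "0 < n" "n < m"
  shows "n \<in> Gam m A"
  unfolding Gam_def using AA_smult[OF A p(1), of "inverse (coeff p n)"] p n
  by (auto intro!: bexI[of _ "smult (inverse (coeff p n)) p"])

text \<open>A first nonzero coefficient below \<open>m\<close> would sit at 0 or, by
  \<open>order_in_Gam\<close>, in \<open>Gam m A\<close>. The index 0 is added by hand because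
  \<open>Gam\<close> starts at 1.\<close>

lemma coeff_eq_0_if_Gam:
  assumes A: "A \<in> AA m" and p: "p \<in> A"
    and zero: "\<And>\<gamma>. \<gamma> \<in> insert 0 (Gam m A) \<Longrightarrow> coeff p \<gamma> = 0" and j: "j < m"
  shows "coeff p j = 0"
  using j
proof (induction j rule: less_induct)
  case (less j)
  then have "coeff p i = 0" if "i < j" for i
    using that by simp
  then show ?case
    using order_in_Gam[OF A p, of j] zero[of j] less.prems by (cases "j = 0") auto
qed

text \<open>
  This will characterise \<open>canon m A \<gamma>\<close>. Reducedness at one \<open>\<gamma>\<close> does not refer to the other basis
  elements, which makes the description operator in \<open>canon\<close> tractable.
\<close>

definition is_reduced :: "nat \<Rightarrow> 'k::field poly set \<Rightarrow> nat \<Rightarrow> 'k poly \<Rightarrow> bool" where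
  "is_reduced m A \<gamma> p \<longleftrightarrow> p \<in> A \<and> (\<forall>j\<ge>m. coeff p j = 0) \<and> (\<forall>j<\<gamma>. coeff p j = 0) \<and>
     (\<forall>j\<in>Gam m A. coeff p j = (if j = \<gamma> then 1 else 0))"

section \<open>Existence and uniqueness of reduced elements\<close>

lemma Gam_bounds: "\<gamma> \<in> Gam m A \<Longrightarrow> 0 < \<gamma> \<and> \<gamma> < m"
  by (auto simp: Gam_def)

lemma finite_Gam: "finite (Gam m A)"
  by (simp add: Gam_def)

text \<open>The difference vanishes at 0 and on \<open>Gam m A\<close>, hence at every index below
  \<open>m\<close>, and by reducedness also from \<open>m\<close> on.\<close>

lemma is_reduced_unique:
  assumes A: "A \<in> AA m" and \<gamma>: "\<gamma> \<in> Gam m A" and "is_reduced m A \<gamma> p" "is_reduced m A \<gamma> q"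
  shows "p = q"
proof -
  have "p \<in> A" "q \<in> A"
    using assms(3,4) by (auto simp: is_reduced_def)
  moreover have "coeff (p - q) j = 0" if "j \<in> insert 0 (Gam m A)" for j
    using assms that Gam_bounds[OF \<gamma>] by (auto simp: is_reduced_def)
  ultimately have "coeff (p - q) j = 0" if "j < m" for j
    using that coeff_eq_0_if_Gam[OF A AA_diff[OF A]] by blast
  moreover have "coeff (p - q) j = 0" if "\<not> j < m" for j
    using that assms(3,4) by (simp add: is_reduced_def)
  ultimately show ?thesis
    by (metis coeff_0 eq_iff_diff_eq_0 poly_eqI)
qed

text \<open>Gaussian elimination: starting from an element of order \<gamma>, the coefficients at
  larger \<open>n\<close> in \<open>Gam m A\<close> are cleared in increasing order. Subtracting a
  multiple of an element of order \<open>n\<close> leaves everything below \<open>n\<close>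
  intact.\<close>

lemma is_reduced_exists:
  assumes A: "A \<in> AA m" and \<gamma>: "\<gamma> \<in> Gam m A"
  shows "\<exists>p. is_reduced m A \<gamma> p"
proof -
  have "\<exists>p\<in>A. (\<forall>j<\<gamma>. coeff p j = 0) \<and> coeff p \<gamma> = 1 \<and>
      (\<forall>j\<in>Gam m A. j < n \<longrightarrow> coeff p j = (if j = \<gamma> then 1 else 0))" for n
  proof (induction n)
    case 0
    then show ?case using \<gamma> by (auto simp: Gam_def)
  next
    case (Suc n)
    then obtain p where p: "p \<in> A" "\<forall>j<\<gamma>. coeff p j = 0" "coeff p \<gamma> = 1"
      "\<forall>j\<in>Gam m A. j < n \<longrightarrow> coeff p j = (if j = \<gamma> then 1 else 0)" by blast
    show ?case
    proof (cases "n \<in> Gam m A \<and> \<gamma> < n")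
      case True
      then obtain q where q: "q \<in> A" "coeff q n = 1" "\<forall>j<n. coeff q j = 0"
        by (auto simp: Gam_def)
      have "p - smult (coeff p n) q \<in> A"
        by (intro AA_diff[OF A] AA_smult[OF A] p q)
      with p q True show ?thesis
        by (intro bexI[of _ "p - smult (coeff p n) q"]) (auto simp: less_Suc_eq)
    next
      case False
      then have "coeff p n = (if n = \<gamma> then 1 else 0)" if "n \<in> Gam m A"
        using that p by (cases "n = \<gamma>") auto
      then show ?thesis
        using p by (intro bexI[of _ p]) (auto simp: less_Suc_eq)
    qed
  qed
  from this[of m] obtain p where p: "p \<in> A" "\<forall>j<\<gamma>. coeff p j = 0" "coeff p \<gamma> = 1"
    "\<forall>j\<in>Gam m A. j < m \<longrightarrow> coeff p j = (if j = \<gamma> then 1 else 0)" by blast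
  \<comment> \<open>Truncation clears the indices from \<open>m\<close> on and does not touch those
    in \<open>Gam m A\<close>.\<close>
  have "is_reduced m A \<gamma> (poly_cutoff m p)"
    using p AA_poly_cutoff[OF A p(1)] Gam_bounds[of _ m A]
    by (auto simp: is_reduced_def coeff_poly_cutoff)
  then show ?thesis ..
qed

lemma is_reduced_if_canonical:
  assumes A: "A \<in> AA m" and f: "is_canonical_basis m A f" and \<gamma>: "\<gamma> \<in> Gam m A"
  shows "is_reduced m A \<gamma> (f \<gamma>)"
proof -
  interpret vector_space "smult :: 'a \<Rightarrow> _"
    by (rule vector_space_smult)
  have "f \<gamma> \<in> span (insert 1 (f ` Gam m A))"
    using \<gamma> by (intro span_base) auto
  then have "f \<gamma> \<in> Abar m A"
    using f by (simp add: is_canonical_basis_def)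
  moreover obtain c where c: "f \<gamma> = monom 1 \<gamma> + (\<Sum>\<delta>\<in>CGam m (Gam m A) \<gamma>. monom (c \<delta>) \<delta>)"
    using f \<gamma> by (auto simp: is_canonical_basis_def)
  have "coeff (f \<gamma>) j = (if j = \<gamma> then 1 else 0)" if "j \<notin> CGam m (Gam m A) \<gamma>" for j
    unfolding c using that by (auto simp: coeff_sum intro!: sum.neutral)
  then have "coeff (f \<gamma>) j = (if j = \<gamma> then 1 else 0)" if "j \<in> Gam m A \<or> j < \<gamma>" for j
    using that by (auto simp: CGam_def)
  ultimately show ?thesis
    using \<gamma> by (auto simp: is_reduced_def Abar_eq[OF A])
qed

text \<open>On the indices in \<open>Gam m A\<close> together with 0, the coefficient matrix of the
  family is the identity. Coefficients there are therefore coordinates, which yields both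
  independence and spanning.\<close>

lemma canonical_basis_if_is_reduced:
  fixes A :: "'k::field poly set"
  assumes A: "A \<in> AA m" and m: "m > 0" and f: "\<And>\<gamma>. \<gamma> \<in> Gam m A \<Longrightarrow> is_reduced m A \<gamma> (f \<gamma>)"
  shows "is_canonical_basis m A f"
proof -
  interpret vector_space "smult :: 'k \<Rightarrow> _"
    by (rule vector_space_smult)
  define G where "G = insert 0 (Gam m A)"
  \<comment> \<open>The constant 1 becomes the member with index 0, so the basis is one family over
    \<open>G\<close>.\<close>
  define h where "h = f(0 := 1)"
  have 0: "0 \<notin> Gam m A" using Gam_bounds by blast
  have G: "finite G" "\<And>\<gamma>. \<gamma> \<in> G \<Longrightarrow> \<gamma> < m"
    using m Gam_bounds by (auto simp: G_def finite_Gam)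
  have coeff_h: "coeff (h \<gamma>) j = (if j = \<gamma> then 1 else 0)" if "\<gamma> \<in> G" "j \<in> G" for \<gamma> j
    using that f[of \<gamma>] 0 Gam_bounds[of \<gamma> m A] by (auto simp: G_def h_def is_reduced_def coeff_1)
  have h_Abar: "h \<gamma> \<in> Abar m A" if "\<gamma> \<in> G" for \<gamma>
    using that f[of \<gamma>] 0 m AA_1[OF A] by (auto simp: G_def h_def is_reduced_def Abar_eq[OF A] coeff_1)
  have "h ` Gam m A = f ` Gam m A"
    using 0 by (intro image_cong) (auto simp: h_def)
  then have h_image: "insert 1 (f ` Gam m A) = h ` G"
    by (simp add: G_def) (simp add: h_def)
  have "inj_on h G"
  proof (rule inj_onI)
    fix x y assume "x \<in> G" "y \<in> G" "h x = h y"
    then show "x = y"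
      using coeff_h[of x x] coeff_h[of y x] by (auto split: if_splits)
  qed
  have coeff_comb: "coeff (\<Sum>\<gamma>\<in>G. smult (u \<gamma>) (h \<gamma>)) j = u j" if j: "j \<in> G" for u j
  proof -
    have "coeff (\<Sum>\<gamma>\<in>G. smult (u \<gamma>) (h \<gamma>)) j = (\<Sum>\<gamma>\<in>G. if \<gamma> = j then u j else 0)"
      unfolding coeff_sum using j by (intro sum.cong) (auto simp: coeff_h)
    then show ?thesis using j G by simp
  qed
  have indep: "independent (h ` G)"
  proof (rule independent_if_scalars_zero)
    fix u x assume "(\<Sum>x\<in>h ` G. smult (u x) x) = 0" "x \<in> h ` G"
    then show "u x = 0"
      using coeff_comb[of _ "u \<circ> h"] \<open>inj_on h G\<close> by (auto simp: sum.reindex)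
  qed (use G in auto)
  have span: "span (h ` G) = Abar m A"
  proof
    have "subspace (Abar m A)"
      unfolding subspace_def Abar_eq[OF A]
      by (auto intro: AA_0[OF A] AA_add[OF A] AA_smult[OF A])
    then show "span (h ` G) \<subseteq> Abar m A"
      using h_Abar by (intro span_minimal) auto
    show "Abar m A \<subseteq> span (h ` G)"
    proof
      fix p assume p: "p \<in> Abar m A"
      \<comment> \<open>The coefficients of \<open>p\<close> at the indices in \<open>G\<close> are
        the only possible coordinates; \<open>p - q\<close> then vanishes on
        \<open>G\<close>.\<close>
      define q where "q = (\<Sum>\<gamma>\<in>G. smult (coeff p \<gamma>) (h \<gamma>))"
      have "q \<in> Abar m A"
        unfolding q_def using h_Abar
        by (intro subspace_sum subspace_scale \<open>subspace (Abar m A)\<close>)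
      with p have pq: "p - q \<in> Abar m A"
        using \<open>subspace (Abar m A)\<close> subspace_diff by blast
      have "coeff (p - q) j = 0" for j
      proof (cases "j < m")
        case True
        have "coeff (p - q) \<gamma> = 0" if "\<gamma> \<in> insert 0 (Gam m A)" for \<gamma>
          unfolding q_def coeff_diff using that by (subst coeff_comb) (auto simp: G_def)
        moreover have "p - q \<in> A" using pq by (simp add: Abar_eq[OF A])
        ultimately show ?thesis
          using coeff_eq_0_if_Gam[OF A _ _ True] by blast
      next
        case False
        then show ?thesis using pq by (auto simp: Abar_eq[OF A])
      qed
      then have "p = q" by (simp add: poly_eq_iff)
      moreover have "q \<in> span (h ` G)"
        unfolding q_def by (intro span_sum span_scale span_base imageI)
      ultimately show "p \<in> span (h ` G)" by simp
    qed
  qed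
  have form: "f \<gamma> = monom 1 \<gamma> + (\<Sum>\<delta>\<in>CGam m (Gam m A) \<gamma>. monom (coeff (f \<gamma>) \<delta>) \<delta>)"
    if \<gamma>: "\<gamma> \<in> Gam m A" for \<gamma>
  proof (rule poly_eqI)
    fix j
    have "finite (CGam m (Gam m A) \<gamma>)"
      by (rule finite_subset[of _ "{..m}"]) (auto simp: CGam_def)
    then have "coeff (\<Sum>\<delta>\<in>CGam m (Gam m A) \<gamma>. monom (coeff (f \<gamma>) \<delta>) \<delta>) j
        = (if j \<in> CGam m (Gam m A) \<gamma> then coeff (f \<gamma>) j else 0)"
      by (simp add: coeff_sum)
    moreover have "coeff (f \<gamma>) j = (if j = \<gamma> then 1 else 0)" if "j \<notin> CGam m (Gam m A) \<gamma>"
    proof -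
      from that consider "m \<le> j" | "j < \<gamma>" | "j \<in> Gam m A"
        using \<gamma> by (fastforce simp: CGam_def)
      then show ?thesis
        using f[OF \<gamma>] Gam_bounds[OF \<gamma>] by cases (auto simp: is_reduced_def)
    qed
    moreover have "\<gamma> \<notin> CGam m (Gam m A) \<gamma>"
      by (simp add: CGam_def)
    ultimately show "coeff (f \<gamma>) j = coeff (monom 1 \<gamma> +
        (\<Sum>\<delta>\<in>CGam m (Gam m A) \<gamma>. monom (coeff (f \<gamma>) \<delta>) \<delta>)) j"
      by auto
  qed
  show ?thesis
    unfolding is_canonical_basis_def h_image
    by (intro conjI ballI exI) (erule form, rule indep, rule span)
qed

text \<open>The description in \<open>canon\<close> is justified: choosing reduced elements gives a
  canonical basis, and the value of any canonical basis at \<gamma> is reduced, hence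
  unique.\<close>

lemma is_reduced_canon:
  assumes A: "A \<in> AA m" and m: "m > 0" and \<gamma>: "\<gamma> \<in> Gam m A"
  shows "is_reduced m A \<gamma> (canon m A \<gamma>)"
proof -
  have "\<forall>\<gamma>\<in>Gam m A. \<exists>p. is_reduced m A \<gamma> p"
    using is_reduced_exists[OF A] by blast
  from bchoice[OF this] obtain f where "\<And>\<gamma>. \<gamma> \<in> Gam m A \<Longrightarrow> is_reduced m A \<gamma> (f \<gamma>)"
    by blast
  then have f: "is_canonical_basis m A f"
    by (rule canonical_basis_if_is_reduced[OF A m])
  have "canon m A \<gamma> = f \<gamma>"
    unfolding canon_def
  proof (rule the_equality)
    show "\<exists>g. is_canonical_basis m A g \<and> f \<gamma> = g \<gamma>" using f by blast
    show "p = f \<gamma>" if "\<exists>g. is_canonical_basis m A g \<and> p = g \<gamma>" for p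
      using that is_reduced_unique[OF A \<gamma>] is_reduced_if_canonical[OF A _ \<gamma>] f by blast
  qed
  then show ?thesis
    using is_reduced_if_canonical[OF A f \<gamma>] by simp
qed

subsection \<open>A semigroup with a single indecomposable element\<close>

text \<open>Decomposing repeatedly ends in copies of \<nu>; conversely, adding \<nu> repeatedly
  stays in \<Gamma> as long as the sum is below \<open>m\<close>.\<close>

lemma SS_principal:
  assumes \<Gamma>: "\<Gamma> \<in> SS m" and ind: "ind \<Gamma> = {\<nu>}"
  shows "\<Gamma> = {a * \<nu> | a. 0 < a \<and> a * \<nu> < m}"
proof -
  have \<nu>: "\<nu> \<in> \<Gamma>" using ind by (auto simp: ind_def)
  then have ne: "\<Gamma> \<subseteq> {2..m - 2}" "\<And>a b. a \<in> \<Gamma> \<Longrightarrow> b \<in> \<Gamma> \<Longrightarrow> a + b < m \<Longrightarrow> a + b \<in> \<Gamma>"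
    using \<Gamma> by (fastforce simp: SS_def)+
  have bounds: "0 < x" "x < m" if "x \<in> \<Gamma>" for x
    using that ne(1) by fastforce+
  have "\<exists>a. 0 < a \<and> x = a * \<nu>" if "x \<in> \<Gamma>" for x
    using that
  proof (induction x rule: less_induct)
    case (less x)
    show ?case
    proof (cases "x \<in> ind \<Gamma>")
      case True
      then show ?thesis using ind by (intro exI[of _ 1]) simp
    next
      case False
      then obtain b c where bc: "b \<in> \<Gamma>" "c \<in> \<Gamma>" "x = b + c"
        using less.prems by (auto simp: ind_def decomposable_def)
      \<comment> \<open>Both summands are positive, hence smaller than \<open>x\<close>.\<close>
      then obtain p q where "0 < p" "b = p * \<nu>" "c = q * \<nu>"
        using less.IH[of b] less.IH[of c] bounds[of b] bounds[of c] by auto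
      then show ?thesis
        using bc by (intro exI[of _ "p + q"]) (simp add: distrib_right)
    qed
  qed
  moreover have "Suc a * \<nu> < m \<Longrightarrow> Suc a * \<nu> \<in> \<Gamma>" for a
  proof (induction a)
    case (Suc a)
    then show ?case using ne(2)[OF \<nu>, of "Suc a * \<nu>"] by simp
  qed (simp add: \<nu>)
  ultimately show ?thesis
    using bounds by (fastforce dest: gr0_implies_Suc)
qed

section \<open>Powers of an element of order \<nu>\<close>

lemma coeff_0_power_eq_1: "coeff g 0 = 1 \<Longrightarrow> coeff (g ^ n) 0 = (1 :: 'k::comm_semiring_1)"
  by (induction n) (simp_all add: coeff_mult_0)

text \<open>Factoring f as \<open>x^\<nu> g\<close> with constant coefficient 1 in \<open>g\<close>
  makes the order and the lowest coefficient of the powers visible.\<close>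

lemma power_order:
  fixes f :: "'k::comm_semiring_1 poly"
  assumes "coeff f \<nu> = 1" "\<And>j. j < \<nu> \<Longrightarrow> coeff f j = 0"
  shows "coeff (f ^ a) (a * \<nu>) = 1" and "j < a * \<nu> \<Longrightarrow> coeff (f ^ a) j = 0"
proof -
  define g where "g = poly_shift \<nu> f"
  have f: "f = monom 1 \<nu> * g"
    unfolding g_def using assms(2) by (rule low_order_eq_monom_mult)
  have "coeff g 0 = 1"
    using assms(1) by (simp add: g_def coeff_poly_shift)
  then show "coeff (f ^ a) (a * \<nu>) = 1" "j < a * \<nu> \<Longrightarrow> coeff (f ^ a) j = 0"
    using coeff_0_power_eq_1[of g a]
    by (simp_all add: f power_mult_distrib monom_power coeff_monom_mult mult.commute[of \<nu>])
qed

text \<open>The lowest term of an element of \<open>A\<close> below x^m has an exponent of the form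
  \<open>a * \<nu>\<close>, so a multiple of \<open>f ^ a\<close> cancels it. The induction runs
  from order \<open>m\<close>, where only x^m q remains, down to order 0.\<close>

lemma AA_span_powers:
  assumes A: "A \<in> AA m" and f: "f \<in> A" "coeff f \<nu> = 1" "\<And>j. j < \<nu> \<Longrightarrow> coeff f j = 0"
    and Gam: "Gam m A = {a * \<nu> | a. 0 < a \<and> a * \<nu> < m}"
    and K: "\<And>a. a * \<nu> < m \<Longrightarrow> a < K" and p: "p \<in> A"
  shows "\<exists>c q. p = (\<Sum>a<K. smult (c a) (f ^ a)) + monom 1 m * q"
proof -
  have "\<exists>c q. p = (\<Sum>a<K. smult (c a) (f ^ a)) + monom 1 m * q"
    if "n \<le> m" "p \<in> A" "\<And>j. j < n \<Longrightarrow> coeff p j = 0" for n p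
    using that
  proof (induction n arbitrary: p rule: inc_induct)
    case base
    then show ?case
      using low_order_eq_monom_mult[of m p] by (intro exI[of _ "\<lambda>_. 0"] exI[of _ "poly_shift m p"]) simp
  next
    case (step n)
    show ?case
    proof (cases "coeff p n = 0")
      case True
      then show ?thesis
        using step.prems by (intro step.IH) (auto simp: less_Suc_eq)
    next
      case False
      have "n = 0 \<or> n \<in> Gam m A"
        using order_in_Gam[OF A \<open>p \<in> A\<close> False] step.prems(2) step.hyps by blast
      \<comment> \<open>The constant term is covered by \<open>a = 0\<close>, that is, by
        \<open>f ^ 0 = 1\<close>.\<close>
      then obtain a where a: "n = a * \<nu>"
        unfolding Gam using that[of 0] that by auto
      define q where "q = p - smult (coeff p n) (f ^ a)"
      have "q \<in> A"
        unfolding q_def by (intro AA_diff[OF A] AA_smult[OF A] AA_power[OF A] f step.prems)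
      moreover have "coeff q j = 0" if "j < Suc n" for j
        using that power_order[OF f(2,3)] step.prems by (auto simp: q_def a less_Suc_eq)
      ultimately obtain c r where q: "q = (\<Sum>a<K. smult (c a) (f ^ a)) + monom 1 m * r"
        using step.IH by blast
      have "(\<Sum>b<K. smult (if b = a then coeff p n else 0) (f ^ b))
          = (\<Sum>b<K. if b = a then smult (coeff p n) (f ^ a) else 0)"
        by (intro sum.cong) auto
      also have "\<dots> = smult (coeff p n) (f ^ a)"
        using K[of a] a step.hyps by simp
      finally have "p = (\<Sum>b<K. smult (c b + (if b = a then coeff p n else 0)) (f ^ b)) + monom 1 m * r"
        using q by (simp add: q_def smult_add_left sum.distrib algebra_simps)
      then show ?thesis
        by (intro exI[of _ "\<lambda>b. c b + (if b = a then coeff p n else 0)"] exI[of _ r])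
    qed
  qed
  from this[of 0 p] p show ?thesis by simp
qed

text \<open>At index \<open>a * \<nu>\<close> only the summand of \<open>f ^ a\<close> contributes:
  earlier coefficients are already 0, while later powers and x^m q start at higher orders.\<close>

lemma powers_independent:
  fixes f :: "'k::field poly"
  assumes f: "coeff f \<nu> = 1" "\<And>j. j < \<nu> \<Longrightarrow> coeff f j = 0" and \<nu>: "\<nu> > 0"
    and K: "\<And>a. a < K \<Longrightarrow> a * \<nu> < m"
    and eq: "(\<Sum>a<K. smult (c a) (f ^ a)) + monom 1 m * q = 0"
  shows "\<forall>a<K. c a = 0" and "q = 0"
proof -
  have "a < K \<longrightarrow> c a = 0" for a
  proof (induction a rule: less_induct)
    case (less a)
    show ?case
    proof
      assume a: "a < K"
      have "coeff (smult (c b) (f ^ b)) (a * \<nu>) = (if b = a then c a else 0)" if "b < K" for b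
        using less.IH[of b] that power_order[OF f] \<nu>
        by (cases b a rule: linorder_cases) auto
      then have "coeff (\<Sum>b<K. smult (c b) (f ^ b)) (a * \<nu>) = (\<Sum>b<K. if b = a then c a else 0)"
        unfolding coeff_sum by (intro sum.cong) auto
      then have "coeff ((\<Sum>b<K. smult (c b) (f ^ b)) + monom 1 m * q) (a * \<nu>) = c a"
        using a K[OF a] by (simp add: coeff_monom_mult)
      then show "c a = 0" using eq by simp
    qed
  qed
  then show c: "\<forall>a<K. c a = 0" by blast
  then show "q = 0" using eq by simp
qed

section \<open>Generators and defining relations of the algebra\<close>

lemma meval_in_AA:
  assumes A: "A \<in> AA m" and "\<And>v. v \<in> V \<Longrightarrow> a v \<in> A" "P \<in> mpolys_in V"
  shows "meval a P \<in> A"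
proof -
  have prod: "(\<Prod>v\<in>T. a v ^ n v) \<in> A" if "T \<subseteq> V" for T n
    using that
    by (induction T rule: infinite_finite_induct)
      (auto intro: AA_1[OF A] AA_mult[OF A] AA_power[OF A] assms(2))
  show ?thesis
    unfolding meval_def using assms(3)
    by (intro AA_sum[OF A] AA_smult[OF A] prod) (auto simp: mpolys_in_def)
qed

theorem lemma2p14:
  fixes A :: "'k::field poly set" and m \<nu> :: nat and \<Gamma> :: "nat set"
  assumes "m \<ge> 4"
    and "\<Gamma> \<in> SS m"
    and "A \<in> AAG m \<Gamma>"
    and "ind \<Gamma> = {\<nu>}"
  shows "presented_by A (gens m) (gen_val m (canon m A \<nu>))
    ({(Var GF ^ ((m - 1) div \<nu> + 1), bracket m (canon m A \<nu> ^ ((m - 1) div \<nu> + 1)))}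
     \<union> {(Var (GX i) * Var (GX j), bracket m (monom 1 (2 * m + i + j))) | i j. i < m \<and> j < m}
     \<union> {(Var (GX i) * Var GF, bracket m (monom 1 (m + i) * canon m A \<nu>)) | i. i < m})"
    (is "presented_by A ?V (gen_val m ?f) ?R")
proof -
  define K where "K = (m - 1) div \<nu> + 1"
  define R where "R = ?R"
  define I where "I = mideal_in ?V {l - r | l r. (l, r) \<in> R}"
  have m: "m > 0" using assms(1) by simp
  have A: "A \<in> AA m" and Gam: "Gam m A = \<Gamma>"
    using assms(3) by (auto simp: AAG_def)
  have \<nu>: "\<nu> \<in> Gam m A"
    using assms(4) Gam by (auto simp: ind_def)
  then have \<nu>_pos: "\<nu> > 0"
    using Gam_bounds by blast
  have Gam_eq: "Gam m A = {a * \<nu> | a. 0 < a \<and> a * \<nu> < m}"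
    using SS_principal[OF assms(2,4)] Gam by simp
  \<comment> \<open>Thus \<open>K\<close> counts the exponents from 0 up to the largest
    \<open>a\<close> with \<open>a * \<nu> \<le> m - 1\<close>, as spanning and independence both
    require.\<close>
  have K_iff: "a < K \<longleftrightarrow> a * \<nu> < m" for a
    using m \<nu>_pos by (auto simp: K_def less_Suc_eq_le less_eq_div_iff_mult_less_eq)
  have f: "?f \<in> A" "coeff ?f \<nu> = 1" "\<And>j. j < \<nu> \<Longrightarrow> coeff ?f j = 0"
    using is_reduced_canon[OF A m \<nu>] \<nu> by (auto simp: is_reduced_def)
  have X: "Var (GX i) \<in> mpolys_in ?V" if "i < m" for i
    using that by (intro mpolys_in_Var) (simp add: gens_def)
  have F: "Var GF \<in> mpolys_in ?V"
    by (intro mpolys_in_Var) (simp add: gens_def)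
  have R_in: "fst ` R \<subseteq> mpolys_in ?V" "snd ` R \<subseteq> mpolys_in ?V"
    unfolding R_def using X F bracket_in_mpolys_in[OF m] by (auto intro!: mpolys_in_mult mpolys_in_power)
  have cutoff_0: "poly_cutoff m p = 0" if "\<And>j. j < m \<Longrightarrow> coeff p j = 0" for p :: "'k poly"
    using that by (simp add: poly_eq_iff coeff_poly_cutoff)
  have fK: "coeff (?f ^ K) j = 0" if "j < m" for j
    using that K_iff[of K] power_order(2)[OF f(2,3), of _ K] by auto
  \<comment> \<open>Every left-hand side has a value of order at least \<open>m\<close>; its
    truncation is 0, so it agrees with the value of its bracket.\<close>
  have eval_R: "meval (gen_val m ?f) (l - r) = 0" if "(l, r) \<in> R" for l r
    using that fK cutoff_0 unfolding K_def R_def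
    by (auto simp: meval_diff meval_mult meval_power meval_Var meval_bracket[OF m] mult_monom
        coeff_monom_mult mult_2 add_ac)
  have eval_comb: "meval (gen_val m ?f) ((\<Sum>a<K. Const (c a) * Var GF ^ a) + tail m q)
      = (\<Sum>a<K. smult (c a) (?f ^ a)) + monom 1 m * q" for c q
    by (simp add: meval_add meval_sum meval_mult meval_power meval_Var meval_Const meval_tail[OF m])
  have eval_gen: "gen_val m ?f v \<in> A" if "v \<in> ?V" for v
    using that f(1) AA_high_order[OF A, of "monom 1 (m + _)"] by (auto simp: gens_def)
  have "meval (gen_val m ?f) ` mpolys_in ?V = A"
  proof
    show "meval (gen_val m ?f) ` mpolys_in ?V \<subseteq> A"
      using meval_in_AA[OF A, of ?V "gen_val m ?f"] eval_gen by auto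
    show "A \<subseteq> meval (gen_val m ?f) ` mpolys_in ?V"
    proof
      fix p assume "p \<in> A"
      then obtain c q where p: "p = (\<Sum>a<K. smult (c a) (?f ^ a)) + monom 1 m * q"
        using AA_span_powers[OF A f Gam_eq, of K p] K_iff by blast
      have "(\<Sum>a<K. Const (c a) * Var GF ^ a) + tail m q \<in> mpolys_in ?V"
        by (intro mpolys_in_intros tail_in_mpolys_in m) (simp add: gens_def)
      then show "p \<in> meval (gen_val m ?f) ` mpolys_in ?V"
        unfolding p eval_comb[symmetric] by (rule imageI)
    qed
  qed
  moreover have "{P \<in> mpolys_in ?V. meval (gen_val m ?f) P = 0} = I"
  proof
    have "{l - r | l r. (l, r) \<in> R} \<subseteq> mpolys_in ?V"
      using R_in by (auto intro!: mpolys_in_diff)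
    then have "I \<subseteq> mpolys_in ?V"
      unfolding I_def by (rule mideal_in_subset_mpolys_in)
    moreover have eval_I: "meval (gen_val m ?f) P = 0" if "P \<in> I" for P
      using that unfolding I_def by (rule meval_mideal_in_eq_0[rotated]) (use eval_R in blast)
    ultimately show "I \<subseteq> {P \<in> mpolys_in ?V. meval (gen_val m ?f) P = 0}"
      by blast
    show "{P \<in> mpolys_in ?V. meval (gen_val m ?f) P = 0} \<subseteq> I"
    proof safe
      fix P assume P: "P \<in> mpolys_in ?V" "meval (gen_val m ?f) P = 0"
      have in_I: "l - r \<in> I" if "(l, r) \<in> R" for l r
        unfolding I_def using that by (intro mideal_in_base) blast
      have "\<exists>c q. P - ((\<Sum>a<K. Const (c a) * Var GF ^ a) + tail m q) \<in> I"
      proof (rule normal_form[where m = m and R = "{l - r | l r. (l, r) \<in> R}", folded I_def,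
            OF m _ _ _ _ P(1)])
        \<comment> \<open>Here \<open>g\<close> is \<open>poly_shift m (?f ^ K)\<close>, the
          quotient of f^K by x^m.\<close>
        show "Var GF ^ K - tail m (poly_shift m (?f ^ K)) \<in> I"
          unfolding bracket_eq_tail[OF m, symmetric] by (rule in_I) (simp add: K_def R_def)
        show "Var (GX i) * Var (GX j) - tail m (monom 1 (m + i + j)) \<in> I" if "i < m" "j < m" for i j
          unfolding tail_eq_bracket[OF m] using that
          by (intro in_I) (auto simp: R_def mult_monom mult_2 add_ac)
        show "Var (GX i) * Var GF - tail m (monom 1 i * ?f) \<in> I" if "i < m" for i
          unfolding tail_eq_bracket[OF m] using that
          by (intro in_I) (auto simp: R_def mult_monom simp flip: mult.assoc)
      qed (simp add: K_def)
      then obtain c q where cq: "P - ((\<Sum>a<K. Const (c a) * Var GF ^ a) + tail m q) \<in> I"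
        by blast
      \<comment> \<open>\<open>P\<close> and all elements of the ideal have value 0, hence so has
        the normal form; independence makes the normal form itself 0.\<close>
      from eval_I[OF this] have "(\<Sum>a<K. smult (c a) (?f ^ a)) + monom 1 m * q = 0"
        unfolding meval_diff eval_comb P(2) by (simp only: diff_0 neg_equal_0_iff_equal)
      from powers_independent[OF f(2,3) \<nu>_pos _ this] have "\<forall>a<K. c a = 0" "q = 0"
        using K_iff by auto
      then show "P \<in> I" using cq by simp
    qed
  qed
  ultimately show ?thesis
    unfolding R_def[symmetric] presented_by_def I_def using R_in by blast
qed

end
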